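(* Let $0\le \alpha<1$. If $g(z)=z+\sum_{n=0}^{\infty} \frac{b_n}{z^n}$ is a meromorphic starlike bi-univalent function of order $\alpha$, i.e. $g\in\Sigma_{\mathcal B}^*(\alpha)$, then $$|b_0|\le 2(1-\alpha)\quad\text{and}\quad |b_1|\le (1-\alpha)\sqrt{4\alpha^2-8\alpha+5}.$$
   Context: Let $\Delta=\{z\in\mathbb{C}:1<|z|<\infty\}$. $\Sigma$ denotes the class of all meromorphic univalent (injective) functions $g$ defined on $\Delta$ of the form $g(z)=z+\sum_{n=0}^{\infty} b_n/z^n$. Each $g\in\Sigma$ has an inverse $g^{-1}$ with $g^{-1}(g(z))=z$ for $z\in\Delta$ and $g(g^{-1}(w))=w$ for $M<|w|<\infty$ (some $M>0$), and $g^{-1}(w)=w+\sum_{n=0}^{\infty} B_n/w^n$ for $M<|w|<\infty$. A function $g\in\Sigma$ is meromorphic bi-univalent if $g^{-1}\in\Sigma$, i.e. the inverse function given by this series near $\infty$ is defined (by analytic continuation if necessary) and univalent on all of $\Delta$. The class of meromorphic bi-univalent functions is denoted $\Sigma_{\mathcal B}$. For $0\le\alpha<1$, $\Sigma_{\mathcal B}^*(\alpha)$, the class of meromorphic starlike bi-univalent functions of order $\alpha$, consists of all $g\in\Sigma_{\mathcal B}$ such that, with $h=g^{-1}$, $$\operatorname{Re}\left(\frac{zg'(z)}{g(z)}\right)>\alpha\ (z\in\Delta)\quad\text{and}\quad \operatorname{Re}\left(\frac{wh'(w)}{h(w)}\right)>\alpha\ (w\in\Delta).$$ *)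

theory Defs
  imports "HOL-Complex_Analysis.Complex_Analysis"
begin

definition Delta :: "complex set" where
  "Delta = {z. 1 < norm z}"

definition has_expansion :: "(complex \<Rightarrow> complex) \<Rightarrow> (nat \<Rightarrow> complex) \<Rightarrow> bool" where
  "has_expansion g b \<longleftrightarrow> (\<forall>z\<in>Delta. (\<lambda>n. b n / z ^ n) sums (g z - z))"

text \<open>Only the values on the exterior domain matter: membership in the classes below
  does not depend on the values of a function elsewhere.\<close>

definition Sigma_class :: "(complex \<Rightarrow> complex) set" where
  "Sigma_class = {g. g meromorphic_on Delta \<and> inj_on g Delta \<and> (\<exists>b. has_expansion g b)}"

text \<open>The inverse of \<open>g\<close> is \<open>inv_into Delta g\<close> on \<open>g ` Delta\<close>, which need not contain
  \<open>Delta\<close>. The function \<open>h\<close> is the analytic continuation to \<open>Delta\<close> of its germ at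
  infinity, so \<open>h\<close> is unique on \<open>Delta\<close> if it exists. Agreement is required only near
  infinity.\<close>

definition continued_inverse :: "(complex \<Rightarrow> complex) \<Rightarrow> (complex \<Rightarrow> complex) \<Rightarrow> bool" where
  "continued_inverse g h \<longleftrightarrow> h \<in> Sigma_class \<and>
     (\<exists>M>0. \<forall>w. M < norm w \<longrightarrow> w \<in> g ` Delta \<and> h w = inv_into Delta g w)"

definition Sigma_B :: "(complex \<Rightarrow> complex) set" where
  "Sigma_B = {g \<in> Sigma_class. \<exists>h. continued_inverse g h}"

text \<open>For \<open>\<alpha> \<ge> 0\<close> the convention \<open>x / 0 = 0\<close> is harmless: at a zero of \<open>g\<close> the
  inequality below reads \<open>0 > \<alpha>\<close> and fails.\<close>

definition starlike_of_order :: "real \<Rightarrow> (complex \<Rightarrow> complex) \<Rightarrow> bool" where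
  "starlike_of_order \<alpha> g \<longleftrightarrow> (\<forall>z\<in>Delta. Re (z * deriv g z / g z) > \<alpha>)"

definition Sigma_B_star :: "real \<Rightarrow> (complex \<Rightarrow> complex) set" where
  "Sigma_B_star \<alpha> = {g \<in> Sigma_B. starlike_of_order \<alpha> g \<and>
     (\<exists>h. continued_inverse g h \<and> starlike_of_order \<alpha> h)}"

end

(* In the coordinate x = 1/z one has z g'(z)/g(z) = 1 - b_0 x + (b_0^2 - 2 b_1) x^2 + ...,
   so the Caratheodory coefficient bounds give |b_0| <= 2(1 - a) and
   |b_0^2 - 2 b_1| <= 2(1 - a). The continued inverse starts w - b_0 - b_1/w + ..., so the
   same bound for it reads |b_0^2 + 2 b_1| <= 2(1 - a). Adding the two gives
   |b_1| <= 1 - a, and 4a^2 - 8a + 5 = 4(1 - a)^2 + 1 >= 1. *)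

theory Submission imports Defs begin

section \<open>Coefficient bounds for functions with positive real part\<close>

text \<open>The Cayley transform of \<open>1 + z ^ n * k z\<close> maps into the disc and vanishes at \<open>0\<close> to
  order \<open>n\<close>, so the maximum principle bounds its quotient by \<open>z ^ n\<close>, whose value at \<open>0\<close>
  is \<open>k 0 / 2\<close>.\<close>

lemma caratheodory_leading_coeff:
  fixes k :: "complex \<Rightarrow> complex"
  assumes hol: "k holomorphic_on ball 0 1"
    and "0 < n"
    and Re_pos: "\<And>z. norm z < 1 \<Longrightarrow> 0 < Re (1 + z ^ n * k z)"
  shows "norm (k 0) \<le> 2"
proof -
  \<comment> \<open>For \<open>p = 1 + z ^ n * k z\<close> the Cayley transform
    \<open>(p - 1) / (p + 1)\<close> equals \<open>z ^ n * K z\<close>, so this form of the quotient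
    is already regular at \<open>0\<close>.\<close>
  define K where "K = (\<lambda>z. k z / (2 + z ^ n * k z))"
  have nz: "2 + z ^ n * k z \<noteq> 0" if "norm z < 1" for z
  proof
    assume "2 + z ^ n * k z = 0"
    then have "Re (2 + z ^ n * k z) = 0" by (simp only: zero_complex.sel)
    then show False using Re_pos[OF that] by simp
  qed
  have holK: "K holomorphic_on ball 0 1"
    unfolding K_def by (intro holomorphic_intros hol) (use nz in auto)
  have bound: "norm z ^ n * norm (K z) \<le> 1" if "norm z < 1" for z
  proof -
    define u where "u = z ^ n * k z"
    have "0 < 1 + Re u" using Re_pos[OF that] by (simp add: u_def)
    \<comment> \<open>Since \<open>Re u > -1\<close>, the point \<open>u\<close> is closer to
      \<open>0\<close> than to \<open>-2\<close>.\<close>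
    then have "norm u \<le> norm (2 + u)"
      by (simp add: cmod_def power2_eq_square algebra_simps)
    then have "norm (u / (2 + u)) \<le> 1"
      using nz[OF that] by (simp add: norm_divide u_def)
    then show ?thesis
      by (simp add: K_def u_def norm_mult norm_divide norm_power)
  qed
  have le: "norm (K 0) * r ^ n \<le> 1" if "0 < r" "r < 1" for r :: real
  proof -
    \<comment> \<open>Cauchy's inequality for the derivative of order \<open>0\<close> serves as the
      maximum principle at the centre: on the circle of radius \<open>r\<close> one has
      \<open>norm (K x)\<close> \<le> \<open>1 / r ^ n\<close>. Letting \<open>r\<close> tend to
      \<open>1\<close> below removes the factor.\<close>
    have "norm ((deriv ^^ 0) K 0) \<le> fact 0 * (1 / r ^ n) / r ^ 0"
    proof (rule Cauchy_inequality)
      show "K holomorphic_on ball 0 r"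
        by (rule holomorphic_on_subset[OF holK]) (use that in auto)
      show "continuous_on (cball 0 r) K"
        by (rule continuous_on_subset[OF holomorphic_on_imp_continuous_on[OF holK]])
          (use that in auto)
      show "norm (K x) \<le> 1 / r ^ n" if "norm (0 - x) = r" for x
        using bound[of x] that \<open>0 < r\<close> \<open>r < 1\<close> by (simp add: field_simps)
    qed (use that in auto)
    then show ?thesis using that by (simp add: field_simps)
  qed
  have "((\<lambda>r. norm (K 0) * r ^ n) \<longlongrightarrow> norm (K 0) * 1 ^ n) (at_left (1::real))"
    by (intro tendsto_intros)
  moreover have "\<forall>\<^sub>F r in at_left (1::real). norm (K 0) * r ^ n \<le> 1"
    using eventually_at_left_real[of 0 "1::real"] le by (auto elim!: eventually_mono)
  ultimately have "norm (K 0) \<le> 1"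
    using tendsto_upperbound[of _ _ "at_left (1::real)" 1] by force
  then show ?thesis
    using \<open>0 < n\<close> by (simp add: K_def norm_divide power_0_left)
qed

text \<open>Averaging over \<open>z\<close> and \<open>- z\<close> removes the linear term.\<close>

lemma caratheodory_second_coeff:
  fixes m :: "complex \<Rightarrow> complex"
  assumes hol: "m holomorphic_on ball 0 1"
    and Re_pos: "\<And>z. norm z < 1 \<Longrightarrow> 0 < Re (1 + z * (c + z * m z))"
  shows "norm (m 0) \<le> 2"
proof -
  define M where "M = (\<lambda>z. (m z + m (- z)) / 2)"
  have "(\<lambda>z. m (- z)) holomorphic_on ball 0 1"
    by (rule holomorphic_on_compose_gen[of "\<lambda>z. - z" "ball 0 1" m "ball 0 1", unfolded o_def])
      (auto intro!: holomorphic_on_minus holomorphic_on_ident hol)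
  then have "M holomorphic_on ball 0 1"
    unfolding M_def by (intro holomorphic_intros hol) auto
  moreover have "0 < Re (1 + z ^ 2 * M z)" if "norm z < 1" for z
  proof -
    have "1 + z ^ 2 * M z =
        ((1 + z * (c + z * m z)) + (1 + (- z) * (c + (- z) * m (- z)))) / 2"
      by (simp add: M_def field_simps power2_eq_square)
    then have "Re (1 + z ^ 2 * M z) =
        (Re (1 + z * (c + z * m z)) + Re (1 + (- z) * (c + (- z) * m (- z)))) / 2"
      by (simp only: Re_divide_numeral plus_complex.sel)
    then show ?thesis
      using Re_pos[of z] Re_pos[of "- z"] that by (simp del: times_complex.sel)
  qed
  ultimately have "norm (M 0) \<le> 2"
    by (intro caratheodory_leading_coeff[of M 2]) auto
  then show ?thesis by (simp add: M_def)
qed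

section \<open>The expansion at infinity in the coordinate \<open>x = 1 / z\<close>\<close>

text \<open>Every nonzero \<open>x\<close> in the unit disc is \<open>1 / z\<close> for some
  \<open>z\<close> in \<open>Delta\<close>, so convergence on \<open>Delta\<close> makes the power
  series with coefficients \<open>b\<close> converge on the whole disc. Its sum \<open>G\<close> and
  the difference quotient \<open>H\<close> of \<open>G\<close> at \<open>0\<close> carry the two
  coefficients of interest as values at \<open>0\<close>, which spares later comparisons of
  series.\<close>

lemma has_expansionE:
  assumes "has_expansion g b"
  obtains G H where
    "G holomorphic_on ball 0 1" "H holomorphic_on ball 0 1"
    "\<And>x. norm x < 1 \<Longrightarrow> G x = b 0 + x * H x" "H 0 = b 1"
    "\<And>z. z \<in> Delta \<Longrightarrow> g z = z + G (1 / z)"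
proof -
  define H where "H = (\<lambda>x. \<Sum>n. b (Suc n) * x ^ n)"
  define G where "G = (\<lambda>x. \<Sum>n. b n * x ^ n)"
  have sm: "summable (\<lambda>n. b n * x ^ n)" if "norm x < 1" for x
  proof (cases "x = 0")
    case False
    then have "1 / x \<in> Delta" using that by (simp add: Delta_def norm_divide)
    then have "(\<lambda>n. b n / (1 / x) ^ n) sums (g (1 / x) - 1 / x)"
      using assms by (auto simp: has_expansion_def)
    then show ?thesis by (auto simp: power_one_over sums_iff)
  qed simp
  have smS: "summable (\<lambda>n. b (Suc n) * x ^ n)" if "norm x < 1" for x
  proof (cases "x = 0")
    case False
    have "summable (\<lambda>n. b (Suc n) * x ^ Suc n)"
      using sm[OF that] by (subst summable_Suc_iff)
    then have "summable (\<lambda>n. (b (Suc n) * x ^ Suc n) * (1 / x))"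
      by (rule summable_mult2)
    then show ?thesis using False by simp
  qed simp
  show thesis
  proof
    show "G holomorphic_on ball 0 1"
      using power_series_holomorphic[of 0 1 b G] sm by (simp add: G_def summable_sums)
    show "H holomorphic_on ball 0 1"
      using power_series_holomorphic[of 0 1 "\<lambda>n. b (Suc n)" H] smS
      by (simp add: H_def summable_sums)
    show "G x = b 0 + x * H x" if "norm x < 1" for x
    proof -
      have "(\<Sum>n. b (Suc n) * x ^ Suc n) = x * H x"
        unfolding H_def suminf_mult[OF smS[OF that], symmetric] by (simp add: mult_ac)
      then show ?thesis
        using suminf_split_head[OF sm[OF that]] by (simp add: G_def)
    qed
    show "H 0 = b 1" by (simp add: H_def)
    show "g z = z + G (1 / z)" if "z \<in> Delta" for z
    proof -
      have "(\<lambda>n. b n / z ^ n) sums (g z - z)"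
        using assms that by (auto simp: has_expansion_def)
      then have "G (1 / z) = g z - z" by (auto simp: G_def sums_iff power_one_over)
      then show ?thesis by simp
    qed
  qed
qed

section \<open>Coefficient bounds from starlikeness\<close>

lemma starlike_nonzero:
  assumes "starlike_of_order \<alpha> g" "0 \<le> \<alpha>" "z \<in> Delta"
  shows "g z \<noteq> 0"
  using assms by (force simp: starlike_of_order_def)

text \<open>Normalizing \<open>z * deriv g z / g z\<close> by subtracting \<alpha> and dividing by 1
  - \<alpha> gives a function of \<open>x = 1 / z\<close> with positive real part and value 1 at
  \<open>x = 0\<close>. Its first two Taylor coefficients are \<open>- b 0\<close> and
  \<open>(b 0)^2 - 2 * b 1\<close>, each divided by 1 - \<alpha>.\<close>

lemma starlike_coeff_bounds:
  assumes \<alpha>: "0 \<le> \<alpha>" "\<alpha> < 1"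
    and star: "starlike_of_order \<alpha> g"
    and ex: "has_expansion g b"
  shows "norm (b 0) \<le> 2 * (1 - \<alpha>)"
    and "norm ((b 0)\<^sup>2 - 2 * b 1) \<le> 2 * (1 - \<alpha>)"
proof -
  obtain G H where holG: "G holomorphic_on ball 0 1" and holH: "H holomorphic_on ball 0 1"
    and GH: "\<And>x. norm x < 1 \<Longrightarrow> G x = b 0 + x * H x" and H0: "H 0 = b 1"
    and gG: "\<And>z. z \<in> Delta \<Longrightarrow> g z = z + G (1 / z)"
    using has_expansionE[OF ex] by metis
  have G0: "G 0 = b 0" using GH[of 0] by simp
  have nz: "1 + x * G x \<noteq> 0" if "norm x < 1" for x
  proof (cases "x = 0")
    case False
    then have "1 / x \<in> Delta" using that by (simp add: Delta_def norm_divide)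
    then have "1 / x + G x \<noteq> 0"
      using starlike_nonzero[OF star \<alpha>(1)] gG by fastforce
    then show ?thesis using False by (simp add: field_simps)
  qed simp
  \<comment> \<open>This is the remainder of the normalized function after its constant and linear
    terms, divided by \<open>x ^ 2\<close>. The identity \<open>G x - b 0 = x * H x\<close> supplies
    the second factor \<open>x\<close>, so \<open>m\<close> is holomorphic at \<open>0\<close>
    too.\<close>
  define m where "m = (\<lambda>x. (b 0 * G x - H x - deriv G x) / (1 + x * G x) / (1 - \<alpha>))"
  have holG': "deriv G holomorphic_on ball 0 1"
    by (intro holomorphic_deriv holG) auto
  have holm: "m holomorphic_on ball 0 1"
    unfolding m_def by (intro holomorphic_intros holG holH holG') (use nz \<alpha> in auto)
  define k where "k = (\<lambda>x. - b 0 / (1 - \<alpha>) + x * m x)"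
  have holk: "k holomorphic_on ball 0 1"
    unfolding k_def by (intro holomorphic_intros holm) (use \<alpha> in auto)
  have Re_pos: "0 < Re (1 + x * k x)" if "norm x < 1" for x
  proof (cases "x = 0")
    case False
    define z where "z = 1 / x"
    have z: "z \<in> Delta" "z \<noteq> 0" "x = 1 / z"
      using that False by (auto simp: Delta_def norm_divide z_def)
    have "(G has_field_derivative deriv G x) (at x)"
      using holomorphic_derivI[OF holG, of x] that by simp
    then have "((\<lambda>y. y + G (1 / y)) has_field_derivative 1 - deriv G x * x\<^sup>2) (at z)"
      unfolding z(3)
      by (auto intro!: derivative_eq_intros DERIV_chain2[where f = G] z(2)
          simp: power2_eq_square)
    moreover have "open Delta"
      unfolding Delta_def by (intro open_Collect_less continuous_intros)
    ultimately have "(g has_field_derivative 1 - deriv G x * x\<^sup>2) (at z)"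
      using has_field_derivative_transform_within_open[of _ _ z Delta g] gG z(1) by auto
    then have "deriv g z = 1 - deriv G x * x\<^sup>2" by (rule DERIV_imp_deriv)
    moreover have "\<alpha> < Re (z * deriv g z / g z)"
      using star z(1) by (simp add: starlike_of_order_def)
    \<comment> \<open>Here \<open>g z = (1 + x * G x) / x\<close>, and \<open>z = 1 / x\<close>
      cancels the remaining \<open>x\<close>.\<close>
    moreover have "z * (1 - deriv G x * x\<^sup>2) / g z = (1 - deriv G x * x\<^sup>2) / (1 + x * G x)"
      using gG[OF z(1)] nz[OF that] False by (simp add: z_def field_simps)
    moreover have "1 + x * k x = ((1 - deriv G x * x\<^sup>2) / (1 + x * G x) - \<alpha>) / (1 - \<alpha>)"
    proof -
      define d where "d = 1 + x * G x"
      define e where "e = 1 - complex_of_real \<alpha>"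
      have de: "d \<noteq> 0" "e \<noteq> 0"
        using nz[OF that] \<alpha> by (auto simp: d_def e_def)
      define N where "N = b 0 * G x - H x - deriv G x"
      have "k x = - b 0 / e + x * (N / d / e)"
        by (simp add: k_def m_def d_def e_def N_def)
      then have "k x * (d * e) = - b 0 * d + x * N"
        using de by (simp add: field_simps)
      then have "x * k x * (d * e) = x * (- b 0 * d + x * N)"
        by (simp only: mult.assoc)
      also have "\<dots> = (1 - deriv G x * x\<^sup>2) - d"
        unfolding d_def N_def GH[OF that] by (simp add: algebra_simps power2_eq_square)
      finally have xk: "x * k x = ((1 - deriv G x * x\<^sup>2) - d) / (d * e)"
        using de by (simp add: eq_divide_eq)
      have \<alpha>_e: "complex_of_real (1 - \<alpha>) = e" "complex_of_real \<alpha> = 1 - e" by (simp_all add: e_def)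
      show ?thesis
        unfolding xk \<alpha>_e d_def[symmetric] using de by (simp add: field_simps)
    qed
    ultimately have "1 + x * k x = (z * deriv g z / g z - \<alpha>) / of_real (1 - \<alpha>)"
      by simp
    then have "Re (1 + x * k x) = (Re (z * deriv g z / g z) - \<alpha>) / (1 - \<alpha>)"
      by (simp only: Re_divide_of_real minus_complex.sel Re_complex_of_real)
    then show ?thesis
      using \<open>\<alpha> < Re (z * deriv g z / g z)\<close> \<alpha> by simp
  qed simp
  have norm_e: "norm (1 - complex_of_real \<alpha>) = 1 - \<alpha>"
    using \<alpha> by (metis abs_of_nonneg diff_ge_0_iff_ge less_imp_le norm_of_real of_real_1 of_real_diff)
  have "norm (k 0) \<le> 2"
    using caratheodory_leading_coeff[OF holk, of 1] Re_pos by simp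
  then show "norm (b 0) \<le> 2 * (1 - \<alpha>)"
    using \<alpha> by (simp add: k_def norm_divide norm_e field_simps)
  \<comment> \<open>Both \<open>H 0\<close> and \<open>deriv G 0\<close> equal \<open>b 1\<close>;
    together they produce the term \<open>2 * b 1\<close> in \<open>m 0\<close>.\<close>
  have "deriv G 0 = b 1"
  proof (rule DERIV_imp_deriv)
    have "(H has_field_derivative deriv H 0) (at 0)"
      using holomorphic_derivI[OF holH, of 0] by simp
    then have "((\<lambda>x. b 0 + x * H x) has_field_derivative b 1) (at 0)"
      by (auto intro!: derivative_eq_intros simp: H0)
    then show "(G has_field_derivative b 1) (at 0)"
      by (rule has_field_derivative_transform_within_open[of _ _ _ "ball 0 1"]) (auto simp: GH)
  qed
  then have "m 0 = ((b 0)\<^sup>2 - 2 * b 1) / (1 - \<alpha>)"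
    by (simp add: m_def G0 H0 power2_eq_square)
  moreover have "norm (m 0) \<le> 2"
    by (rule caratheodory_second_coeff[OF holm, of "- b 0 / (1 - \<alpha>)"])
      (use Re_pos in \<open>simp add: k_def\<close>)
  ultimately have "norm ((b 0)\<^sup>2 - 2 * b 1) / (1 - \<alpha>) \<le> 2"
    by (simp add: norm_divide norm_e)
  then show "norm ((b 0)\<^sup>2 - 2 * b 1) \<le> 2 * (1 - \<alpha>)"
    using \<alpha> by (simp add: divide_le_eq)
qed

section \<open>The first two coefficients of the continued inverse\<close>

text \<open>Near infinity \<open>g (h w) = w\<close>. In the coordinate \<open>x = 1 / w\<close>
  this is a functional equation between the two expansions, and both coefficients follow by letting
  \<open>x\<close> tend to \<open>0\<close>.\<close>

lemma continued_inverse_coeffs: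
  assumes inv: "continued_inverse g h"
    and nonzero: "\<And>w. w \<in> Delta \<Longrightarrow> h w \<noteq> 0"
    and exg: "has_expansion g b" and exh: "has_expansion h B"
  shows "B 0 = - b 0" and "B 1 = - b 1"
proof -
  obtain G H where holG: "G holomorphic_on ball 0 1" and holH: "H holomorphic_on ball 0 1"
    and GH: "\<And>x. norm x < 1 \<Longrightarrow> G x = b 0 + x * H x" and H0: "H 0 = b 1"
    and gG: "\<And>z. z \<in> Delta \<Longrightarrow> g z = z + G (1 / z)"
    using has_expansionE[OF exg] by metis
  \<comment> \<open>The primes mark the functions belonging to \<open>h\<close>; they do not denote
    derivatives.\<close>
  obtain G' H' where holG': "G' holomorphic_on ball 0 1"
    and holH': "H' holomorphic_on ball 0 1"
    and GH': "\<And>x. norm x < 1 \<Longrightarrow> G' x = B 0 + x * H' x" and H'0: "H' 0 = B 1"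
    and hG': "\<And>z. z \<in> Delta \<Longrightarrow> h z = z + G' (1 / z)"
    using has_expansionE[OF exh] by metis
  obtain M where "M > 0"
    and M: "\<And>w. M < norm w \<Longrightarrow> w \<in> g ` Delta \<and> h w = inv_into Delta g w"
    using inv by (auto simp: continued_inverse_def)
  \<comment> \<open>For \<open>0 < norm x < r\<close> the point \<open>w = 1 / x\<close> satisfies
    \<open>norm w > M\<close> and lies in \<open>Delta\<close>.\<close>
  define r where "r = min 1 (1 / M)"
  have "0 < r" using \<open>M > 0\<close> by (simp add: r_def)
  \<comment> \<open>For small nonzero \<open>x\<close> this is \<open>1 / h (1 / x)\<close>, the
    coordinate at which \<open>G\<close> has to be evaluated in \<open>g (h w) = w\<close>.\<close>
  define t where "t = (\<lambda>x. x / (1 + x * G' x))"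
  have key: "G' x = - G (t x) \<and> norm (t x) < 1 \<and> 1 + x * G' x \<noteq> 0"
    if "norm x < r" "x \<noteq> 0" for x
  proof -
    define w where "w = 1 / x"
    have "M < norm w" "w \<in> Delta"
      using that \<open>M > 0\<close> by (auto simp: w_def Delta_def norm_divide r_def field_simps)
    have "h w \<in> Delta" "g (h w) = w"
      using M[OF \<open>M < norm w\<close>] by (auto simp: inv_into_into f_inv_into_f)
    have hw: "h w = (1 + x * G' x) / x"
      using hG'[OF \<open>w \<in> Delta\<close>] that by (simp add: w_def field_simps)
    have t: "t x = 1 / h w" by (simp add: hw t_def)
    have "norm (t x) < 1"
      using \<open>h w \<in> Delta\<close> by (simp add: t Delta_def norm_divide divide_less_eq)
    moreover have "w = h w + G (t x)"
      using gG[OF \<open>h w \<in> Delta\<close>] \<open>g (h w) = w\<close> by (simp add: t)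
    then have "G' x = - G (t x)"
      using hG'[OF \<open>w \<in> Delta\<close>] by (simp add: w_def algebra_simps add_eq_0_iff)
    moreover have "1 + x * G' x \<noteq> 0"
      using nonzero[OF \<open>w \<in> Delta\<close>] by (auto simp: hw)
    ultimately show ?thesis by simp
  qed
  have cont: "(f \<longlongrightarrow> f 0) (at 0)" if "f holomorphic_on ball 0 1" for f :: "complex \<Rightarrow> complex"
    using holomorphic_on_imp_continuous_on[OF that]
    by (auto simp: continuous_on_eq_continuous_at isCont_def)
  have den: "((\<lambda>x. 1 + x * G' x) \<longlongrightarrow> 1) (at 0)"
    by (rule tendsto_eq_intros cont[OF holG'] refl | simp)+
  have lim_t: "(t \<longlongrightarrow> 0) (at 0)"
    unfolding t_def by (rule tendsto_eq_intros den refl | simp)+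
  have compose: "((\<lambda>x. f (t x)) \<longlongrightarrow> f 0) (at 0)" if "f holomorphic_on ball 0 1"
    for f :: "complex \<Rightarrow> complex"
    using cont[OF that] by (intro isCont_tendsto_compose[OF _ lim_t]) (simp add: isCont_def)
  have near0: "\<forall>\<^sub>F x in at 0. norm x < r \<and> x \<noteq> (0 :: complex)"
    using \<open>0 < r\<close> by (auto simp: eventually_at intro!: exI[of _ r])
  have "\<forall>\<^sub>F x in at 0. - G (t x) = G' x"
    using near0 by (rule eventually_mono) (use key in auto)
  moreover have "((\<lambda>x. - G (t x)) \<longlongrightarrow> - G 0) (at 0)"
    by (intro tendsto_minus compose holG)
  ultimately have "(G' \<longlongrightarrow> - G 0) (at 0)"
    by (rule Lim_transform_eventually[rotated])
  then have "G' 0 = - G 0"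
    by (rule tendsto_unique[OF at_neq_bot cont[OF holG']])
  then show B0: "B 0 = - b 0" using GH[of 0] GH'[of 0] by simp
  \<comment> \<open>With the constant terms matched, \<open>G' x = - G (t x)\<close> reduces to
    \<open>x * H' x = - t x * H (t x)\<close>; substituting \<open>t x\<close> and cancelling
    \<open>x\<close> isolates \<open>H' x\<close>.\<close>
  have "\<forall>\<^sub>F x in at 0. - H (t x) / (1 + x * G' x) = H' x"
    using near0
  proof (rule eventually_mono)
    fix x :: complex assume x: "norm x < r \<and> x \<noteq> 0"
    then have "norm x < 1" by (simp add: r_def)
    have "x * H' x = - (t x * H (t x))"
      using key[of x] x GH'[OF \<open>norm x < 1\<close>] GH[of "t x"] B0 by simp
    then have "x * H' x = x * (- H (t x) / (1 + x * G' x))"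
      by (simp add: t_def)
    then show "- H (t x) / (1 + x * G' x) = H' x" using x by (metis mult_left_cancel)
  qed
  moreover have "((\<lambda>x. - H (t x) / (1 + x * G' x)) \<longlongrightarrow> - H 0 / 1) (at 0)"
    by (intro tendsto_divide tendsto_minus compose holH den) simp
  ultimately have "(H' \<longlongrightarrow> - H 0 / 1) (at 0)"
    by (rule Lim_transform_eventually[rotated])
  then have "H' 0 = - H 0 / 1"
    by (rule tendsto_unique[OF at_neq_bot cont[OF holH']])
  then show "B 1 = - b 1" by (simp add: H0 H'0)
qed

section \<open>Combining the bounds for the function and its continued inverse\<close>

theorem theorem1:
  fixes \<alpha> :: real and g :: "complex \<Rightarrow> complex" and b :: "nat \<Rightarrow> complex"
  assumes "0 \<le> \<alpha>" and "\<alpha> < 1"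
    and "g \<in> Sigma_B_star \<alpha>"
    and "has_expansion g b"
  shows "norm (b 0) \<le> 2 * (1 - \<alpha>) \<and>
         norm (b 1) \<le> (1 - \<alpha>) * sqrt (4 * \<alpha>\<^sup>2 - 8 * \<alpha> + 5)"
proof -
  obtain h where g: "starlike_of_order \<alpha> g"
    and inv: "continued_inverse g h" and h: "starlike_of_order \<alpha> h"
    using assms(3) by (auto simp: Sigma_B_star_def)
  obtain B where B: "has_expansion h B"
    using inv by (auto simp: continued_inverse_def Sigma_class_def)
  note bg = starlike_coeff_bounds[OF assms(1,2) g assms(4)]
  have "B 0 = - b 0" "B 1 = - b 1"
    using continued_inverse_coeffs[OF inv _ assms(4) B] starlike_nonzero[OF h assms(1)] by auto
  \<comment> \<open>The sign change leaves \<open>(b 0)^2\<close> fixed and flips the term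
    \<open>2 * b 1\<close>, so \<open>b 0\<close> drops out of the difference of the two bounded
    quantities.\<close>
  then have bh: "norm ((b 0)\<^sup>2 + 2 * b 1) \<le> 2 * (1 - \<alpha>)"
    using starlike_coeff_bounds(2)[OF assms(1,2) h B] by simp
  have "4 * norm (b 1) = norm (((b 0)\<^sup>2 + 2 * b 1) - ((b 0)\<^sup>2 - 2 * b 1))"
    by (simp add: norm_mult)
  also have "\<dots> \<le> 4 * (1 - \<alpha>)"
    using norm_triangle_ineq4[of "(b 0)\<^sup>2 + 2 * b 1" "(b 0)\<^sup>2 - 2 * b 1"] bg(2) bh by linarith
  finally have "norm (b 1) \<le> (1 - \<alpha>) * 1" by simp
  also have "\<dots> \<le> (1 - \<alpha>) * sqrt (4 * \<alpha>\<^sup>2 - 8 * \<alpha> + 5)"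
  proof (rule mult_left_mono)
    have "4 * \<alpha>\<^sup>2 - 8 * \<alpha> + 5 = 4 * (1 - \<alpha>)\<^sup>2 + 1"
      by (simp add: power2_eq_square algebra_simps)
    then show "1 \<le> sqrt (4 * \<alpha>\<^sup>2 - 8 * \<alpha> + 5)" by simp
  qed (use assms(2) in simp)
  finally show ?thesis using bg(1) by simp
qed

end
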